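(* Consider the linear-quadratic control problem described in the context. For each $0\le t\le T-1$ fix a matrix $P_t\in\mathbb{R}^{m\times n}$ and a vector $E_t\in\mathbb{R}^m$, and consider the policy $\alpha_t(x)=P_tx+E_t$, $0\le t\le T-1$. If the DDP algorithm is started with this policy, i.e. with $$\underline{V}^0_t(x)=\mathbb{E}\Big[\sum_{s=t}^{T-1}\big(x_s^{\top}Q_sx_s+\alpha_s(x_s)^{\top}R_s\alpha_s(x_s)\big)+x_T^{\top}Q_Tx_T\,\Big|\,x_t=x\Big],\quad 0\le t\le T,$$ where $x_{s+1}=D_sx_s+B_s\alpha_s(x_s)+\xi_s$, then it terminates after two iterations at the optimal cost function: $\underline{V}^2\equiv V^*$, i.e. $\underline{V}^k_t(x)=V^*_t(x)$ for all $k\ge2$, $0\le t\le T$ and $x\in\mathbb{R}^n$.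
   Context: Linear-quadratic control problem. The dynamics are $x_{t+1}=D_tx_t+B_ta_t+\xi_t$, $t=0,\dots,T-1$, with states $x_t\in\mathbb{R}^n$ and unconstrained controls $a_t\in\mathbb{R}^m$; the cost is $\sum_{t=0}^{T-1}(x_t^{\top}Q_tx_t+a_t^{\top}R_ta_t)+x_T^{\top}Q_Tx_T$, to be minimized in expectation over policies for which $a_t$ depends only on $x_0,\dots,x_t$. Here $D_t\in\mathbb{R}^{n\times n}$, $B_t\in\mathbb{R}^{n\times m}$, $Q_t\in\mathbb{R}^{n\times n}$ is symmetric positive semidefinite, $R_t\in\mathbb{R}^{m\times m}$ is symmetric positive definite, and $\xi_0,\dots,\xi_{T-1}$ are independent random vectors in $\mathbb{R}^n$ with zero mean and finite second moments. The optimal cost-to-go function is $$V^*_t(x)=x^{\top}K_tx+\sum_{s=t}^{T-1}\mathbb{E}[\xi_s^{\top}K_{s+1}\xi_s],$$ where $K_T=Q_T$ and $K_t=D_t^{\top}\big(K_{t+1}-K_{t+1}B_t(R_t+B_t^{\top}K_{t+1}B_t)^{-1}B_t^{\top}K_{t+1}\big)D_t+Q_t$ for $t=0,\dots,T-1$. DDP (duality-driven dynamic programming) algorithm. Starting from $\underline{V}^0=(\underline{V}^0_0,\dots,\underline{V}^0_T)$, for $k\ge1$ put $\underline{V}^k_T(x)=x^{\top}Q_Tx$ and, for $0\le t\le T-1$, $$\underline{V}^k_t(x)=\mathbb{E}\Big[\inf_{a=(a_t,\dots,a_{T-1})\in(\mathbb{R}^m)^{T-t}}\Big(\sum_{s=t}^{T-1}\big(x_s^{\top}Q_sx_s+a_s^{\top}R_sa_s\big)+x_T^{\top}Q_Tx_T+z^k_t(a,\xi)\Big)\Big|\,x_t=x\Big],$$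 where the infimum is taken separately for each realization of $\xi=(\xi_t,\dots,\xi_{T-1})$, the states satisfy $x_{s+1}=D_sx_s+B_sa_s+\xi_s$, and $$z^k_t(a,\xi)=\sum_{s=t}^{T-1}\Big\{\mathbb{E}\big[\underline{V}^{k-1}_{s+1}(D_sx_s+B_sa_s+\xi_s)\big]-\underline{V}^{k-1}_{s+1}(D_sx_s+B_sa_s+\xi_s)\Big\},$$ the inner expectation being over $\xi_s$ only, with $x_s,a_s$ fixed. The iteration stops once it produces no further change. *)

theory Defs
  imports "HOL-Probability.Probability"
begin

definition sym_psd :: "real^'n^'n \<Rightarrow> bool" where
  "sym_psd A \<longleftrightarrow> transpose A = A \<and> (\<forall>x. 0 \<le> x \<bullet> (A *v x))"

definition sym_pd :: "real^'n^'n \<Rightarrow> bool" where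
  "sym_pd A \<longleftrightarrow> transpose A = A \<and> (\<forall>x. x \<noteq> 0 \<longrightarrow> 0 < x \<bullet> (A *v x))"

(* lq_state D B u w t x s is the state x_s when x_t = x, the controls are a_r = u r x_r
   and w is the realized noise.  Open-loop controls a are the feedback (\<lambda>r _. a r).
   Meaningful for s \<ge> t; for s < t the value is the dummy x. *)
primrec lq_state ::
  "(nat \<Rightarrow> real^'n^'n) \<Rightarrow> (nat \<Rightarrow> real^'m^'n) \<Rightarrow> (nat \<Rightarrow> real^'n \<Rightarrow> real^'m)
    \<Rightarrow> (nat \<Rightarrow> real^'n) \<Rightarrow> nat \<Rightarrow> real^'n \<Rightarrow> nat \<Rightarrow> real^'n" where
  "lq_state D B u w t x 0 = x"
| "lq_state D B u w t x (Suc s) =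
    (if s < t then x
     else D s *v lq_state D B u w t x s + B s *v u s (lq_state D B u w t x s) + w s)"

definition lq_cost ::
  "nat \<Rightarrow> (nat \<Rightarrow> real^'n^'n) \<Rightarrow> (nat \<Rightarrow> real^'m^'n) \<Rightarrow> (nat \<Rightarrow> real^'n^'n) \<Rightarrow> (nat \<Rightarrow> real^'m^'m)
    \<Rightarrow> (nat \<Rightarrow> real^'n \<Rightarrow> real^'m) \<Rightarrow> (nat \<Rightarrow> real^'n) \<Rightarrow> nat \<Rightarrow> real^'n \<Rightarrow> real" where
  "lq_cost T D B Q R u w t x =
    (let X = lq_state D B u w t x
     in (\<Sum>s=t..<T. X s \<bullet> (Q s *v X s) + u s (X s) \<bullet> (R s *v u s (X s))) + X T \<bullet> (Q T *v X T))"

(* As the noise is independent over time, conditioning the cost from time t on x_t = x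
   amounts to starting the dynamics at time t from the deterministic state x. *)
definition policy_cost ::
  "'w measure \<Rightarrow> (nat \<Rightarrow> 'w \<Rightarrow> real^'n) \<Rightarrow> nat \<Rightarrow> (nat \<Rightarrow> real^'n^'n) \<Rightarrow> (nat \<Rightarrow> real^'m^'n)
    \<Rightarrow> (nat \<Rightarrow> real^'n^'n) \<Rightarrow> (nat \<Rightarrow> real^'m^'m) \<Rightarrow> (nat \<Rightarrow> real^'n \<Rightarrow> real^'m)
    \<Rightarrow> nat \<Rightarrow> real^'n \<Rightarrow> real" where
  "policy_cost M \<xi> T D B Q R \<alpha> t x = (\<integral>\<omega>. lq_cost T D B Q R \<alpha> (\<lambda>s. \<xi> s \<omega>) t x \<partial>M)"

definition ddp_penalty ::
  "'w measure \<Rightarrow> (nat \<Rightarrow> 'w \<Rightarrow> real^'n) \<Rightarrow> nat \<Rightarrow> (nat \<Rightarrow> real^'n^'n) \<Rightarrow> (nat \<Rightarrow> real^'m^'n)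
    \<Rightarrow> (nat \<Rightarrow> real^'n \<Rightarrow> real) \<Rightarrow> (nat \<Rightarrow> real^'m) \<Rightarrow> (nat \<Rightarrow> real^'n) \<Rightarrow> nat \<Rightarrow> real^'n \<Rightarrow> real" where
  "ddp_penalty M \<xi> T D B V a w t x =
    (let X = lq_state D B (\<lambda>s _. a s) w t x
     in \<Sum>s=t..<T. (\<integral>\<omega>. V (Suc s) (D s *v X s + B s *v a s + \<xi> s \<omega>) \<partial>M)
                    - V (Suc s) (D s *v X s + B s *v a s + w s))"

definition ddp_step ::
  "'w measure \<Rightarrow> (nat \<Rightarrow> 'w \<Rightarrow> real^'n) \<Rightarrow> nat \<Rightarrow> (nat \<Rightarrow> real^'n^'n) \<Rightarrow> (nat \<Rightarrow> real^'m^'n)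
    \<Rightarrow> (nat \<Rightarrow> real^'n^'n) \<Rightarrow> (nat \<Rightarrow> real^'m^'m) \<Rightarrow> (nat \<Rightarrow> real^'n \<Rightarrow> real)
    \<Rightarrow> nat \<Rightarrow> real^'n \<Rightarrow> real" where
  "ddp_step M \<xi> T D B Q R V t x =
    (if t < T then
       (\<integral>\<omega>. (INF a \<in> {t..<T} \<rightarrow>\<^sub>E UNIV.
                lq_cost T D B Q R (\<lambda>s _. a s) (\<lambda>s. \<xi> s \<omega>) t x
                + ddp_penalty M \<xi> T D B V a (\<lambda>s. \<xi> s \<omega>) t x) \<partial>M)
     else x \<bullet> (Q T *v x))"

definition ddp ::
  "'w measure \<Rightarrow> (nat \<Rightarrow> 'w \<Rightarrow> real^'n) \<Rightarrow> nat \<Rightarrow> (nat \<Rightarrow> real^'n^'n) \<Rightarrow> (nat \<Rightarrow> real^'m^'n)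
    \<Rightarrow> (nat \<Rightarrow> real^'n^'n) \<Rightarrow> (nat \<Rightarrow> real^'m^'m) \<Rightarrow> (nat \<Rightarrow> real^'n \<Rightarrow> real)
    \<Rightarrow> nat \<Rightarrow> nat \<Rightarrow> real^'n \<Rightarrow> real" where
  "ddp M \<xi> T D B Q R V0 k = (ddp_step M \<xi> T D B Q R ^^ k) V0"

function riccati ::
  "nat \<Rightarrow> (nat \<Rightarrow> real^'n^'n) \<Rightarrow> (nat \<Rightarrow> real^'m^'n) \<Rightarrow> (nat \<Rightarrow> real^'n^'n) \<Rightarrow> (nat \<Rightarrow> real^'m^'m)
    \<Rightarrow> nat \<Rightarrow> real^'n^'n" where
  "riccati T D B Q R t =
    (if t < T then
       (let K = riccati T D B Q R (Suc t)
        in transpose (D t)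
           ** (K - K ** B t ** matrix_inv (R t + transpose (B t) ** K ** B t) ** transpose (B t) ** K)
           ** D t + Q t)
     else Q T)"
  by pat_completeness auto
termination
  by (relation "Wellfounded.measure (\<lambda>(T, D, B, Q, R, t). T - t)") auto

declare riccati.simps [simp del]

(* The optimal cost-to-go function V*, given by its closed form through the Riccati matrices. *)
definition opt_cost_to_go ::
  "'w measure \<Rightarrow> (nat \<Rightarrow> 'w \<Rightarrow> real^'n) \<Rightarrow> nat \<Rightarrow> (nat \<Rightarrow> real^'n^'n) \<Rightarrow> (nat \<Rightarrow> real^'m^'n)
    \<Rightarrow> (nat \<Rightarrow> real^'n^'n) \<Rightarrow> (nat \<Rightarrow> real^'m^'m) \<Rightarrow> nat \<Rightarrow> real^'n \<Rightarrow> real" where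
  "opt_cost_to_go M \<xi> T D B Q R t x =
    x \<bullet> (riccati T D B Q R t *v x)
    + (\<Sum>s=t..<T. \<integral>\<omega>. \<xi> s \<omega> \<bullet> (riccati T D B Q R (Suc s) *v \<xi> s \<omega>) \<partial>M)"

end

theory Submission imports Defs begin

text \<open>
  Two observations about the penalty carry the proof.

  First, if \<open>V (Suc t)\<close> is a quadratic polynomial, then the compensated increment
  \<open>E[V (Suc t) (y + \<xi> t)] - V (Suc t) (y + w t)\<close> is affine in \<open>y\<close> for each realization \<open>w\<close> of the
  noise: the quadratic terms in \<open>y\<close> cancel (\<open>penalty_of_quadratic\<close>). The pathwise problem solved in
  a DDP step is therefore a deterministic linear-quadratic problem with the original \<open>D, B, Q, R\<close>
  and additional linear terms. Completing the square backwards in time (\<open>control_min_value\<close>,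
  \<open>min_value_step\<close>), its minimal value is \<open>x \<bullet> K t x + 2 (p \<bullet> x) + q\<close>, where \<open>K\<close> is the
  Riccati matrix for every such \<open>V\<close>, \<open>p\<close> is linear in the noise, and \<open>q\<close> is at most quadratic in it.
  Since the noise has mean zero, so has \<open>p\<close>, and taking expectations leaves \<open>x \<bullet> K t x\<close> plus a
  constant (\<open>ddp_step_quadratic\<close>). The cost of an affine policy is a quadratic polynomial
  (\<open>affine_policy_cost_quadratic\<close>), so this describes the first iterate: only its constants may
  still be wrong.

  Second, constants cancel in the penalty. If \<open>V t\<close> is \<open>x \<bullet> K t x\<close> plus a constant for every \<open>t\<close>,
  then \<open>p\<close> vanishes and the noise drops out of \<open>q\<close> altogether: for every realization the minimal
  value is \<open>V\<^sup>*\<close> itself (\<open>ddp_step_optimal\<close>). Hence the second iterate is \<open>V\<^sup>*\<close>, and as \<open>V\<^sup>*\<close> is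
  again of this form, it stays there.
\<close>

section \<open>Symmetric matrices and the inner product\<close>

lemma inner_transpose_mult_left: "(transpose A *v x) \<bullet> y = x \<bullet> (A *v y)"
  for A :: "real^'a^'b"
  by (simp add: dot_lmul_matrix)

text \<open>Keep adjoints in the form \<open>transpose A *v x\<close>, which the rules for moving matrices across the
  inner product expect.\<close>

declare transpose_matrix_vector [simp del]

lemma inner_mult_left: "(A *v x) \<bullet> y = x \<bullet> (transpose A *v y)"
  for A :: "real^'a^'b"
  by (metis inner_transpose_mult_left transpose_transpose)

lemma transpose_eqI:
  fixes A :: "real^'a^'a"
  assumes "\<And>x y. (A *v x) \<bullet> y = x \<bullet> (A *v y)"
  shows "transpose A = A"
  unfolding matrix_eq by (metis assms inner_mult_left vector_eq_ldot)

lemma matrix_inv_mult_right: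
  assumes "invertible A"
  shows "A ** matrix_inv A = mat 1"
  using assms unfolding invertible_def matrix_inv_def by (rule someI2_ex) simp

lemma matrix_inv_symmetric:
  fixes A :: "real^'a^'a"
  assumes "invertible A" and "transpose A = A"
  shows "transpose (matrix_inv A) = matrix_inv A"
proof -
  have "transpose (matrix_inv A) ** A = mat 1"
    using matrix_inv_mult_right[OF assms(1)] assms(2) by (metis matrix_transpose_mul transpose_mat)
  then show ?thesis
    by (metis assms(1) matrix_inv_mult_right matrix_mul_assoc matrix_mul_lid matrix_mul_rid)
qed

section \<open>Completing the square in one control\<close>

definition gain_matrix :: "real^'m^'m \<Rightarrow> real^'m^'n \<Rightarrow> real^'n^'n \<Rightarrow> real^'m^'m" where
  "gain_matrix R B K = R + transpose B ** K ** B"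

definition minimized_weight :: "real^'m^'m \<Rightarrow> real^'m^'n \<Rightarrow> real^'n^'n \<Rightarrow> real^'n^'n" where
  "minimized_weight R B K =
    K - K ** B ** matrix_inv (gain_matrix R B K) ** transpose B ** K"

lemma gain_matrix_mult: "gain_matrix R B K *v a = R *v a + transpose B *v (K *v (B *v a))"
  by (simp add: gain_matrix_def matrix_vector_mult_add_rdistrib matrix_vector_mul_assoc[symmetric])

lemma gain_matrix_symmetric:
  assumes "sym_psd K" and "sym_pd R"
  shows "transpose (gain_matrix R B K) = gain_matrix R B K"
proof (rule transpose_eqI)
  have K: "(K *v x) \<bullet> y = x \<bullet> (K *v y)" for x y
    using assms(1) inner_mult_left[of K] unfolding sym_psd_def by simp
  have R: "(R *v x) \<bullet> y = x \<bullet> (R *v y)" for x y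
    using assms(2) inner_mult_left[of R] unfolding sym_pd_def by simp
  show "(gain_matrix R B K *v x) \<bullet> y = x \<bullet> (gain_matrix R B K *v y)" for x y
    by (simp add: gain_matrix_mult inner_add_left inner_add_right inner_transpose_mult_left K R
        inner_mult_left[of B])
qed

lemma gain_matrix_pos:
  assumes "sym_psd K" and "sym_pd R" and "a \<noteq> 0"
  shows "0 < a \<bullet> (gain_matrix R B K *v a)"
proof -
  have "a \<bullet> (transpose B *v (K *v (B *v a))) = (B *v a) \<bullet> (K *v (B *v a))"
    by (metis inner_mult_left)
  moreover have "0 \<le> (B *v a) \<bullet> (K *v (B *v a))"
    using assms(1) unfolding sym_psd_def by blast
  moreover have "0 < a \<bullet> (R *v a)"
    using assms unfolding sym_pd_def by blast
  ultimately show ?thesis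
    by (simp add: gain_matrix_mult inner_add_right)
qed

lemma gain_matrix_invertible:
  assumes "sym_psd K" and "sym_pd R"
  shows "invertible (gain_matrix R B K)"
proof -
  have "x = 0" if "gain_matrix R B K *v x = 0" for x
    using gain_matrix_pos[OF assms, of x B] that by fastforce
  then show ?thesis
    by (metis invertible_left_inverse matrix_left_invertible_ker)
qed

lemma minimized_weight_mult:
  "minimized_weight R B K *v x =
    K *v x - K *v (B *v (matrix_inv (gain_matrix R B K) *v (transpose B *v (K *v x))))"
  by (simp add: minimized_weight_def matrix_vector_mult_diff_rdistrib
      matrix_vector_mul_assoc[symmetric])

text \<open>Infima over controls are attained, and the backward recursion needs the minimizer and not only
  the infimum: minimizing controls of consecutive stages are pasted together.\<close>

definition is_min_value :: "('a \<Rightarrow> real) \<Rightarrow> real \<Rightarrow> bool" where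
  "is_min_value f m \<longleftrightarrow> (\<forall>a. m \<le> f a) \<and> (\<exists>a. f a = m)"

text \<open>Without linear cost terms, the optimal control moves an uncontrolled successor state \<open>y\<close> to
  \<open>y - B W B\<^sup>T K y\<close>, where \<open>W\<close> is the inverse of the gain matrix. The adjoint of this map carries
  linear cost terms one step back.\<close>

definition closed_loop_adjoint :: "real^'m^'m \<Rightarrow> real^'m^'n \<Rightarrow> real^'n^'n \<Rightarrow> real^'n^'n" where
  "closed_loop_adjoint R B K = mat 1 - K ** B ** matrix_inv (gain_matrix R B K) ** transpose B"

lemma closed_loop_adjoint_mult:
  "closed_loop_adjoint R B K *v h =
    h - K *v (B *v (matrix_inv (gain_matrix R B K) *v (transpose B *v h)))"
  by (simp add: closed_loop_adjoint_def matrix_vector_mult_diff_rdistrib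
      matrix_vector_mul_assoc[symmetric])

text \<open>With \<open>v = B\<^sup>T (K y + h)\<close> and the gain matrix \<open>G\<close>, the objective equals
  \<open>(a + G\<inverse> v) \<bullet> G (a + G\<inverse> v) - v \<bullet> G\<inverse> v\<close> up to terms without \<open>a\<close>, and \<open>G\<close> is positive
  definite. Expanding \<open>v \<bullet> G\<inverse> v\<close> in powers of \<open>y\<close> produces the minimized weight, the linear
  term and the constant.\<close>

lemma control_min_value:
  fixes R :: "real^'m^'m" and B :: "real^'m^'n" and K :: "real^'n^'n"
  assumes "sym_psd K" and "sym_pd R"
  shows "is_min_value
    (\<lambda>a. a \<bullet> (R *v a) + (y + B *v a) \<bullet> (K *v (y + B *v a)) + 2 * (h \<bullet> (y + B *v a)))
    (y \<bullet> (minimized_weight R B K *v y) + 2 * ((closed_loop_adjoint R B K *v h) \<bullet> y)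
      - h \<bullet> (B *v (matrix_inv (gain_matrix R B K) *v (transpose B *v h))))"
    (is "is_min_value ?f ?m")
proof -
  define G where "G = gain_matrix R B K"
  define W where "W = matrix_inv G"
  define v where "v = transpose B *v (K *v y + h)"
  define g where "g = W *v v"
  have K: "(K *v x) \<bullet> z = x \<bullet> (K *v z)" for x z
    using assms(1) inner_mult_left[of K] unfolding sym_psd_def by simp
  have G: "(G *v x) \<bullet> z = x \<bullet> (G *v z)" for x z
    using gain_matrix_symmetric[OF assms] inner_mult_left[of G] unfolding G_def by simp
  have inv: "invertible G"
    unfolding G_def using assms by (rule gain_matrix_invertible)
  have W: "(W *v x) \<bullet> z = x \<bullet> (W *v z)" for x z
    using matrix_inv_symmetric[OF inv] gain_matrix_symmetric[OF assms] inner_mult_left[of W]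
    unfolding G_def W_def by simp
  have Gg: "G *v g = v"
    unfolding g_def W_def by (simp add: matrix_vector_mul_assoc matrix_inv_mult_right[OF inv])
  have m: "?m = y \<bullet> (K *v y) + 2 * (h \<bullet> y) - v \<bullet> g"
    unfolding v_def g_def G_def[symmetric] W_def[symmetric]
    by (simp add: minimized_weight_mult closed_loop_adjoint_mult G_def[symmetric] W_def[symmetric]
        inner_transpose_mult_left matrix_vector_right_distrib inner_add_left inner_add_right
        inner_diff_left inner_diff_right K W inner_mult_left[of B])
       (simp add: inner_commute[of h] K W inner_transpose_mult_left inner_mult_left[of B])
  have square: "?f a = (a + g) \<bullet> (G *v (a + g)) + ?m" for a
  proof -
    have "?f a = a \<bullet> (G *v a) + 2 * (a \<bullet> v) + y \<bullet> (K *v y) + 2 * (h \<bullet> y)"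
      unfolding v_def G_def gain_matrix_mult
      by (simp add: matrix_vector_right_distrib inner_add_left inner_add_right inner_mult_left[of B])
         (simp add: inner_commute[of h] inner_commute[of y] K inner_mult_left[of B]
           matrix_vector_right_distrib inner_add_right)
    moreover have "(a + g) \<bullet> (G *v (a + g)) = a \<bullet> (G *v a) + 2 * (a \<bullet> v) + v \<bullet> g"
      using G[of g a] by (simp add: matrix_vector_right_distrib inner_add_left inner_add_right Gg
          inner_commute[of v])
    ultimately show ?thesis
      unfolding m by simp
  qed
  have "0 \<le> (a + g) \<bullet> (G *v (a + g))" for a
    using gain_matrix_pos[OF assms, of "a + g" B] unfolding G_def by (cases "a + g = 0") auto
  then have "?m \<le> ?f a" for a
    unfolding square by simp
  moreover have "?f (- g) = ?m"
    unfolding square by simp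
  ultimately show ?thesis
    unfolding is_min_value_def by blast
qed

text \<open>Nonnegativity needs no matrix computation: for \<open>h = 0\<close> the quadratic form of the
  minimized weight is a value of a nonnegative objective.\<close>

lemma minimized_weight_psd:
  assumes "sym_psd K" and "sym_pd R"
  shows "sym_psd (minimized_weight R B K)"
  unfolding sym_psd_def
proof (intro conjI allI)
  let ?G = "gain_matrix R B K"
  have K: "(K *v x) \<bullet> z = x \<bullet> (K *v z)" for x z
    using assms(1) inner_mult_left[of K] unfolding sym_psd_def by simp
  have W: "(matrix_inv ?G *v x) \<bullet> z = x \<bullet> (matrix_inv ?G *v z)" for x z
    using matrix_inv_symmetric[OF gain_matrix_invertible gain_matrix_symmetric, OF assms assms]
      inner_mult_left by metis
  show "transpose (minimized_weight R B K) = minimized_weight R B K"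
    by (rule transpose_eqI)
      (simp add: minimized_weight_mult inner_diff_left inner_diff_right K W
        inner_transpose_mult_left inner_mult_left[of B])
  fix y
  obtain a where "a \<bullet> (R *v a) + (y + B *v a) \<bullet> (K *v (y + B *v a))
      = y \<bullet> (minimized_weight R B K *v y)"
    using control_min_value[OF assms, of y B 0] unfolding is_min_value_def by auto
  moreover have "0 \<le> a \<bullet> (R *v a)"
    using assms(2) unfolding sym_pd_def by (cases "a = 0") (auto intro: less_imp_le)
  moreover have "0 \<le> (y + B *v a) \<bullet> (K *v (y + B *v a))"
    using assms(1) unfolding sym_psd_def by blast
  ultimately show "0 \<le> y \<bullet> (minimized_weight R B K *v y)"
    by linarith
qed

lemma congruence_plus_psd:
  fixes A :: "real^'n^'k"
  assumes "sym_psd S" and "sym_psd Q"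
  shows "sym_psd (transpose A ** S ** A + Q)"
  unfolding sym_psd_def
proof (intro conjI allI)
  have S: "(S *v x) \<bullet> y = x \<bullet> (S *v y)" for x y
    using assms(1) inner_mult_left[of S] unfolding sym_psd_def by simp
  have Q: "(Q *v x) \<bullet> y = x \<bullet> (Q *v y)" for x y
    using assms(2) inner_mult_left[of Q] unfolding sym_psd_def by simp
  have mult: "(transpose A ** S ** A + Q) *v x = transpose A *v (S *v (A *v x)) + Q *v x" for x
    by (simp add: matrix_vector_mult_add_rdistrib matrix_vector_mul_assoc[symmetric])
  show "transpose (transpose A ** S ** A + Q) = transpose A ** S ** A + Q"
    by (rule transpose_eqI)
      (simp add: mult inner_add_left inner_add_right inner_transpose_mult_left S Q
        inner_mult_left[of A])
  fix x
  have "0 \<le> (A *v x) \<bullet> (S *v (A *v x))" and "0 \<le> x \<bullet> (Q *v x)"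
    using assms unfolding sym_psd_def by blast+
  then show "0 \<le> x \<bullet> ((transpose A ** S ** A + Q) *v x)"
    by (simp add: mult inner_add_right inner_mult_left[of A])
qed

section \<open>The Riccati recursion\<close>

lemma riccati_step:
  assumes "t < T"
  shows "riccati T D B Q R t =
    transpose (D t) ** minimized_weight (R t) (B t) (riccati T D B Q R (Suc t)) ** D t + Q t"
  by (subst riccati.simps) (simp add: assms Let_def minimized_weight_def gain_matrix_def)

lemma riccati_end: "riccati T D B Q R T = Q T"
  by (simp add: riccati.simps)

lemma riccati_psd:
  assumes "\<And>t. t \<le> T \<Longrightarrow> sym_psd (Q t)" and "\<And>t. t < T \<Longrightarrow> sym_pd (R t)" and "t \<le> T"
  shows "sym_psd (riccati T D B Q R t)"
  using \<open>t \<le> T\<close>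
proof (induction t rule: inc_induct)
  case base
  then show ?case using assms by (simp add: riccati_end)
next
  case (step t)
  then show ?case
    using assms by (simp add: riccati_step congruence_plus_psd minimized_weight_psd)
qed

section \<open>Peeling off the first stage\<close>

lemma lq_state_start: "lq_state D B u w t x t = x"
  by (cases t) auto

lemma lq_state_shift:
  assumes "Suc t \<le> s"
  shows "lq_state D B u w t x s =
    lq_state D B u w (Suc t) (D t *v x + B t *v u t x + w t) s"
  using assms
proof (induction s rule: dec_induct)
  case base
  show ?case by (simp add: lq_state_start)
next
  case (step s)
  then show ?case by simp
qed

lemma lq_cost_step:
  assumes "t < T"
  shows "lq_cost T D B Q R u w t x = x \<bullet> (Q t *v x) + u t x \<bullet> (R t *v u t x)
    + lq_cost T D B Q R u w (Suc t) (D t *v x + B t *v u t x + w t)"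
  using assms
  by (simp add: lq_cost_def Let_def sum.atLeast_Suc_lessThan lq_state_start lq_state_shift
      del: lq_state.simps)

lemma lq_cost_end: "lq_cost T D B Q R u w T x = x \<bullet> (Q T *v x)"
  by (simp add: lq_cost_def lq_state_start)

lemma ddp_penalty_step:
  assumes "t < T"
  shows "ddp_penalty M \<xi> T D B V a w t x =
    (\<integral>\<omega>. V (Suc t) (D t *v x + B t *v a t + \<xi> t \<omega>) \<partial>M)
      - V (Suc t) (D t *v x + B t *v a t + w t)
    + ddp_penalty M \<xi> T D B V a w (Suc t) (D t *v x + B t *v a t + w t)"
  using assms
  by (simp add: ddp_penalty_def Let_def sum.atLeast_Suc_lessThan lq_state_start lq_state_shift
      del: lq_state.simps)

lemma ddp_penalty_end: "ddp_penalty M \<xi> T D B V a w T x = 0"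
  by (simp add: ddp_penalty_def)


section \<open>Square-integrable random vectors\<close>

text \<open>The linear coefficients of the pathwise value functions are random vectors of this class and the
  constant terms are sums of inner products of such vectors, which makes all expectations finite.\<close>

definition square_integrable :: "'w measure \<Rightarrow> ('w \<Rightarrow> real^'n) \<Rightarrow> bool" where
  "square_integrable M f \<longleftrightarrow>
    f \<in> borel_measurable M \<and> integrable M (\<lambda>\<omega>. (norm (f \<omega>))\<^sup>2)"

lemma square_integrable_inner:
  assumes "square_integrable M f" and "square_integrable M g"
  shows "integrable M (\<lambda>\<omega>. f \<omega> \<bullet> g \<omega>)"
proof (rule Bochner_Integration.integrable_bound)
  show "integrable M (\<lambda>\<omega>. (norm (f \<omega>))\<^sup>2 + (norm (g \<omega>))\<^sup>2)"
    using assms unfolding square_integrable_def by simp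
  show "(\<lambda>\<omega>. f \<omega> \<bullet> g \<omega>) \<in> borel_measurable M"
    using assms unfolding square_integrable_def by (auto intro: borel_measurable_inner)
  have "norm (f \<omega> \<bullet> g \<omega>) \<le> norm ((norm (f \<omega>))\<^sup>2 + (norm (g \<omega>))\<^sup>2)" for \<omega>
  proof -
    have "\<bar>f \<omega> \<bullet> g \<omega>\<bar> \<le> norm (f \<omega>) * norm (g \<omega>)"
      by (rule Cauchy_Schwarz_ineq2)
    moreover have "2 * (norm (f \<omega>) * norm (g \<omega>)) \<le> (norm (f \<omega>))\<^sup>2 + (norm (g \<omega>))\<^sup>2"
      using sum_squares_bound[of "norm (f \<omega>)" "norm (g \<omega>)"] by simp
    moreover have "0 \<le> norm (f \<omega>) * norm (g \<omega>)"
      by simp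
    ultimately show ?thesis
      by simp
  qed
  then show "AE \<omega> in M. norm (f \<omega> \<bullet> g \<omega>) \<le> norm ((norm (f \<omega>))\<^sup>2 + (norm (g \<omega>))\<^sup>2)"
    by simp
qed

lemma square_integrable_mult:
  fixes A :: "real^'n^'k"
  assumes "square_integrable M f"
  shows "square_integrable M (\<lambda>\<omega>. A *v f \<omega>)"
proof -
  have meas [measurable]: "(\<lambda>\<omega>. A *v f \<omega>) \<in> borel_measurable M"
    using assms unfolding square_integrable_def
    by (auto intro!: borel_measurable_continuous_on[where f="(*v) A"] linear_continuous_on)
  obtain c where c: "\<And>x. norm (A *v x) \<le> norm x * c"
    using bounded_linear.bounded[OF matrix_vector_mul_bounded_linear] by blast
  have "integrable M (\<lambda>\<omega>. (norm (A *v f \<omega>))\<^sup>2)"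
  proof (rule Bochner_Integration.integrable_bound)
    show "integrable M (\<lambda>\<omega>. c\<^sup>2 * (norm (f \<omega>))\<^sup>2)"
      using assms unfolding square_integrable_def by simp
    have "(norm (A *v f \<omega>))\<^sup>2 \<le> c\<^sup>2 * (norm (f \<omega>))\<^sup>2" for \<omega>
      using power_mono[OF c[of "f \<omega>"], of 2] by (simp add: power_mult_distrib mult.commute)
    then show "AE \<omega> in M. norm ((norm (A *v f \<omega>))\<^sup>2) \<le> norm (c\<^sup>2 * (norm (f \<omega>))\<^sup>2)"
      by simp
  qed simp
  with meas show ?thesis
    unfolding square_integrable_def by simp
qed

lemma square_integrable_add:
  assumes "square_integrable M f" and "square_integrable M g"
  shows "square_integrable M (\<lambda>\<omega>. f \<omega> + g \<omega>)"
proof -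
  have "integrable M (\<lambda>\<omega>. (norm (f \<omega>))\<^sup>2 + (norm (g \<omega>))\<^sup>2 + 2 * (f \<omega> \<bullet> g \<omega>))"
    using assms square_integrable_inner[OF assms] unfolding square_integrable_def by simp
  then have "integrable M (\<lambda>\<omega>. (norm (f \<omega> + g \<omega>))\<^sup>2)"
    by (simp add: power2_norm_eq_inner inner_add_left inner_add_right inner_commute algebra_simps)
  moreover have "(\<lambda>\<omega>. f \<omega> + g \<omega>) \<in> borel_measurable M"
    using assms unfolding square_integrable_def by (auto intro: borel_measurable_add)
  ultimately show ?thesis
    unfolding square_integrable_def by blast
qed

lemma square_integrable_diff:
  assumes "square_integrable M f" and "square_integrable M g"
  shows "square_integrable M (\<lambda>\<omega>. f \<omega> - g \<omega>)"
proof -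
  have "square_integrable M (\<lambda>\<omega>. - g \<omega>)"
    using assms(2) unfolding square_integrable_def by simp
  from square_integrable_add[OF assms(1) this] show ?thesis
    by simp
qed

context prob_space
begin

lemma square_integrable_const: "square_integrable M (\<lambda>\<omega>. c)"
  by (simp add: square_integrable_def)

lemma square_integrable_integrable:
  assumes "square_integrable M f"
  shows "integrable M f"
proof (rule Bochner_Integration.integrable_bound)
  show "integrable M (\<lambda>\<omega>. 1 + (norm (f \<omega>))\<^sup>2)"
    using assms unfolding square_integrable_def by simp
  show "f \<in> borel_measurable M"
    using assms unfolding square_integrable_def by simp
  have "norm (f \<omega>) \<le> 1 + (norm (f \<omega>))\<^sup>2" for \<omega>
    using sum_squares_bound[of "norm (f \<omega>)" 1] norm_ge_zero[of "f \<omega>"]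
    unfolding one_power2 by linarith
  then show "AE \<omega> in M. norm (f \<omega>) \<le> norm (1 + (norm (f \<omega>))\<^sup>2)"
    by simp
qed

end

section \<open>Pathwise minimization of the penalized cost\<close>

lemma quadratic_shift:
  fixes K :: "real^'n^'n"
  assumes "transpose K = K"
  shows "(z + w) \<bullet> (K *v (z + w)) = z \<bullet> (K *v z) + 2 * ((K *v w) \<bullet> z) + w \<bullet> (K *v w)"
proof -
  have "(K *v w) \<bullet> z = w \<bullet> (K *v z)"
    using inner_mult_left[of K w z] assms by simp
  then show ?thesis
    by (simp add: matrix_vector_right_distrib inner_add_left inner_add_right
        inner_commute[of z "K *v w"])
qed

locale lq_control = prob_space M for M :: "'w measure" +
  fixes \<xi> :: "nat \<Rightarrow> 'w \<Rightarrow> real^'n"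
    and T :: nat
    and D :: "nat \<Rightarrow> real^'n^'n"
    and B :: "nat \<Rightarrow> real^'m^'n"
    and Q :: "nat \<Rightarrow> real^'n^'n"
    and R :: "nat \<Rightarrow> real^'m^'m"
  assumes noise_square_integrable: "t < T \<Longrightarrow> square_integrable M (\<xi> t)"
    and noise_mean: "t < T \<Longrightarrow> (\<integral>\<omega>. \<xi> t \<omega> \<partial>M) = 0"
    and Q_psd: "t \<le> T \<Longrightarrow> sym_psd (Q t)"
    and R_pd: "t < T \<Longrightarrow> sym_pd (R t)"
begin

abbreviation K :: "nat \<Rightarrow> real^'n^'n" where
  "K \<equiv> riccati T D B Q R"

lemma K_psd: "t \<le> T \<Longrightarrow> sym_psd (K t)"
  using Q_psd R_pd by (rule riccati_psd)

definition penalized_cost ::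
  "(nat \<Rightarrow> real^'n \<Rightarrow> real) \<Rightarrow> (nat \<Rightarrow> real^'m) \<Rightarrow> (nat \<Rightarrow> real^'n) \<Rightarrow> nat \<Rightarrow> real^'n \<Rightarrow> real"
  where
  "penalized_cost V a w t x =
    lq_cost T D B Q R (\<lambda>s _. a s) w t x + ddp_penalty M \<xi> T D B V a w t x"

lemma penalized_cost_end: "penalized_cost V a w T x = x \<bullet> (Q T *v x)"
  by (simp add: penalized_cost_def lq_cost_end ddp_penalty_end)

lemma penalized_cost_step:
  assumes "t < T"
  shows "penalized_cost V a w t x =
    x \<bullet> (Q t *v x) + a t \<bullet> (R t *v a t)
    + ((\<integral>\<omega>. V (Suc t) (D t *v x + B t *v a t + \<xi> t \<omega>) \<partial>M)
      - V (Suc t) (D t *v x + B t *v a t + w t))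
    + penalized_cost V a w (Suc t) (D t *v x + B t *v a t + w t)"
  using assms by (simp add: penalized_cost_def lq_cost_step ddp_penalty_step)

lemma penalized_cost_cong:
  assumes "t \<le> T" and "\<And>s. t \<le> s \<Longrightarrow> s < T \<Longrightarrow> a s = a' s"
  shows "penalized_cost V a w t x = penalized_cost V a' w t x"
  using assms
proof (induction t arbitrary: x rule: inc_induct)
  case base
  show ?case by (simp add: penalized_cost_end)
next
  case (step t)
  then show ?case by (simp add: penalized_cost_step)
qed

text \<open>The increment \<open>V (y + v) - V y\<close> is the sum of \<open>v \<bullet> S v\<close> and a term linear in \<open>v\<close>. Under the
  expectation the linear term vanishes because the noise has mean zero, so that \<open>y\<close> survives only in
  the cross term \<open>2 (S w \<bullet> y)\<close> of the realized noise.\<close>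

lemma penalty_of_quadratic:
  assumes "t < T" and "transpose S = S" and V: "\<And>y. V y = y \<bullet> (S *v y) + l \<bullet> y + c"
  shows "(\<integral>\<omega>. V (y + \<xi> t \<omega>) \<partial>M) - V (y + w) =
    (\<integral>\<omega>. \<xi> t \<omega> \<bullet> (S *v \<xi> t \<omega>) \<partial>M) - w \<bullet> (S *v w) - l \<bullet> w - 2 * ((S *v w) \<bullet> y)"
proof -
  note noise = noise_square_integrable[OF \<open>t < T\<close>]
  have V_shift: "V (y + v) = V y + ((2 *\<^sub>R (S *v y) + l) \<bullet> v + v \<bullet> (S *v v))" for v
    unfolding V quadratic_shift[OF assms(2)] using inner_mult_left[of S v y] assms(2)
    by (simp add: inner_add_left inner_add_right inner_commute)
  have "integrable M (\<lambda>\<omega>. \<xi> t \<omega> \<bullet> (S *v \<xi> t \<omega>))"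
    by (intro square_integrable_inner square_integrable_mult noise)
  then have "(\<integral>\<omega>. V (y + \<xi> t \<omega>) \<partial>M) = V y + (\<integral>\<omega>. \<xi> t \<omega> \<bullet> (S *v \<xi> t \<omega>) \<partial>M)"
    unfolding V_shift
    using square_integrable_integrable[OF noise] noise_mean[OF \<open>t < T\<close>]
    by (simp add: prob_space)
  moreover have "(S *v y) \<bullet> w = (S *v w) \<bullet> y"
    using inner_mult_left[of S w y] assms(2) by (simp add: inner_commute)
  ultimately show ?thesis
    unfolding V_shift[of w] by (simp add: inner_add_left)
qed

text \<open>One backward step of the pathwise dynamic program. In terms of \<open>y = D x + B a\<close>, the penalty and
  the value at the next stage add up to \<open>y \<bullet> K y + 2 (h \<bullet> y)\<close> and a term that the control cannot
  influence. The explicit form shows what happens for \<open>S = K\<close>, \<open>p = 0\<close> and \<open>l = 0\<close>: then \<open>h\<close> is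
  zero and the quadratic terms in \<open>w t\<close> cancel.\<close>

lemma min_value_step:
  fixes w :: "nat \<Rightarrow> real^'n"
  defines "h \<equiv> \<lambda>S t p. K (Suc t) *v w t + p - S *v w t"
  assumes "t < T" and "transpose S = S"
    and V: "\<And>y. V (Suc t) y = y \<bullet> (S *v y) + l \<bullet> y + c"
    and next_min: "\<And>y. is_min_value (\<lambda>a. penalized_cost V a w (Suc t) y)
      (y \<bullet> (K (Suc t) *v y) + 2 * (p \<bullet> y) + q)"
  shows "is_min_value (\<lambda>a. penalized_cost V a w t x)
      (x \<bullet> (K t *v x)
        + 2 * ((transpose (D t) *v (closed_loop_adjoint (R t) (B t) (K (Suc t)) *v h S t p)) \<bullet> x)
        + (q + w t \<bullet> (K (Suc t) *v w t) + 2 * (p \<bullet> w t)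
          + (\<integral>\<omega>. \<xi> t \<omega> \<bullet> (S *v \<xi> t \<omega>) \<partial>M) - w t \<bullet> (S *v w t) - l \<bullet> w t
          - h S t p \<bullet> (B t *v (matrix_inv (gain_matrix (R t) (B t) (K (Suc t)))
              *v (transpose (B t) *v h S t p)))))"
    (is "is_min_value ?F ?m")
proof -
  let ?K = "K (Suc t)" and ?h = "h S t p"
  define y where "y a = D t *v x + B t *v a" for a
  \<comment> \<open>the part of the cost from stage \<open>t\<close> on that the control cannot influence\<close>
  define r where "r = x \<bullet> (Q t *v x) + q + w t \<bullet> (?K *v w t) + 2 * (p \<bullet> w t)
    + (\<integral>\<omega>. \<xi> t \<omega> \<bullet> (S *v \<xi> t \<omega>) \<partial>M) - w t \<bullet> (S *v w t) - l \<bullet> w t"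
  define f where "f a = a \<bullet> (R t *v a) + y a \<bullet> (?K *v y a) + 2 * (?h \<bullet> y a)" for a
  have K_sym: "transpose ?K = ?K"
    using K_psd[of "Suc t"] \<open>t < T\<close> unfolding sym_psd_def by simp
  \<comment> \<open>the last summand is nonnegative and measures how far the later controls are from optimal\<close>
  have F: "?F a = r + f (a t) + (penalized_cost V a w (Suc t) (y (a t) + w t)
      - ((y (a t) + w t) \<bullet> (?K *v (y (a t) + w t)) + 2 * (p \<bullet> (y (a t) + w t)) + q))" for a
    unfolding penalized_cost_step[OF \<open>t < T\<close>] y_def[symmetric]
      penalty_of_quadratic[OF \<open>t < T\<close> \<open>transpose S = S\<close> V] quadratic_shift[OF K_sym]
      f_def r_def h_def
    by (simp add: inner_add_left inner_add_right inner_diff_left)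
  have m: "?m = r + ((D t *v x) \<bullet> (minimized_weight (R t) (B t) ?K *v (D t *v x))
      + 2 * ((closed_loop_adjoint (R t) (B t) ?K *v ?h) \<bullet> (D t *v x))
      - ?h \<bullet> (B t *v (matrix_inv (gain_matrix (R t) (B t) ?K) *v (transpose (B t) *v ?h))))"
    (is "_ = r + ?n")
    unfolding r_def riccati_step[OF \<open>t < T\<close>]
    by (simp add: matrix_vector_mult_add_rdistrib matrix_vector_mul_assoc[symmetric]
        inner_add_right inner_transpose_mult_left inner_mult_left[of "D t"])
  have f: "is_min_value f ?n"
    unfolding f_def y_def using K_psd[of "Suc t"] R_pd[of t] \<open>t < T\<close>
    by (intro control_min_value) simp_all
  have "?m \<le> ?F a" for a
    using next_min f unfolding F m is_min_value_def by (smt (verit))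
  moreover have "\<exists>a. ?F a = ?m"
  proof -
    \<comment> \<open>first an optimal control for this stage, then optimal controls from the state it leads to\<close>
    obtain u where u: "f u = ?n"
      using f unfolding is_min_value_def by blast
    obtain a where a: "penalized_cost V a w (Suc t) (y u + w t) =
        (y u + w t) \<bullet> (?K *v (y u + w t)) + 2 * (p \<bullet> (y u + w t)) + q"
      using next_min unfolding is_min_value_def by blast
    have "penalized_cost V (a(t := u)) w (Suc t) (y u + w t) =
        penalized_cost V a w (Suc t) (y u + w t)"
      using \<open>t < T\<close> by (intro penalized_cost_cong) auto
    then have "?F (a(t := u)) = ?m"
      unfolding F m using u a by simp
    then show ?thesis by (intro exI[where x="a(t := u)"])
  qed
  ultimately show ?thesis
    unfolding is_min_value_def by blast
qed

lemma INF_eq_min_value: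
  assumes "t \<le> T" and "is_min_value (\<lambda>a. penalized_cost V a w t x) m"
  shows "(INF a \<in> {t..<T} \<rightarrow>\<^sub>E UNIV. penalized_cost V a w t x) = m"
proof (rule cInf_eq_minimum)
  obtain a where a: "penalized_cost V a w t x = m"
    using assms(2) unfolding is_min_value_def by blast
  have "penalized_cost V (restrict a {t..<T}) w t x = m"
    unfolding a[symmetric] using \<open>t \<le> T\<close> by (intro penalized_cost_cong) auto
  then show "m \<in> (\<lambda>a. penalized_cost V a w t x) ` ({t..<T} \<rightarrow>\<^sub>E UNIV)"
    by (intro image_eqI[where x="restrict a {t..<T}"]) auto
qed (use assms(2) in \<open>auto simp: is_min_value_def\<close>)

lemma ddp_step_eq:
  assumes "t \<le> T"
    and "\<And>\<omega>. is_min_value (\<lambda>a. penalized_cost V a (\<lambda>s. \<xi> s \<omega>) t x) (m \<omega>)"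
  shows "ddp_step M \<xi> T D B Q R V t x = (\<integral>\<omega>. m \<omega> \<partial>M)"
proof (cases "t < T")
  case True
  then show ?thesis
    using INF_eq_min_value[OF assms] unfolding ddp_step_def penalized_cost_def by simp
next
  case False
  then have "t = T"
    using \<open>t \<le> T\<close> by simp
  then have "m \<omega> = x \<bullet> (Q T *v x)" for \<omega>
    using assms(2)[of \<omega>] unfolding is_min_value_def by (metis penalized_cost_end)
  then show ?thesis
    using \<open>t = T\<close> by (simp add: ddp_step_def prob_space)
qed

lemma min_value_end:
  "is_min_value (\<lambda>a. penalized_cost V a w T x) (x \<bullet> (K T *v x))"
  by (simp add: is_min_value_def penalized_cost_end riccati_end)

section \<open>Iterating the DDP step\<close>

text \<open>The quadratic part of the result does not depend on \<open>V\<close>. The induction carries along that the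
  pathwise linear coefficient is square-integrable with mean zero and that the constant term is
  integrable, which is what the final expectation needs.\<close>

lemma ddp_step_quadratic:
  assumes "\<And>t. t < T \<Longrightarrow>
      \<exists>S l c. transpose S = S \<and> (\<forall>y. V (Suc t) y = y \<bullet> (S *v y) + l \<bullet> y + c)"
    and "t \<le> T"
  shows "\<exists>c. \<forall>x. ddp_step M \<xi> T D B Q R V t x = x \<bullet> (K t *v x) + c"
proof -
  have "\<exists>p q. square_integrable M p \<and> (\<integral>\<omega>. p \<omega> \<partial>M) = 0 \<and> integrable M q \<and>
    (\<forall>\<omega> x. is_min_value (\<lambda>a. penalized_cost V a (\<lambda>s. \<xi> s \<omega>) t x)
      (x \<bullet> (K t *v x) + 2 * (p \<omega> \<bullet> x) + q \<omega>))"
    using \<open>t \<le> T\<close>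
  proof (induction t rule: inc_induct)
    case base
    show ?case
      by (rule exI[of _ "\<lambda>_. 0"], rule exI[of _ "\<lambda>_. 0"])
        (simp add: square_integrable_const min_value_end)
  next
    case (step t)
    obtain S l c where S: "transpose S = S"
      and V: "\<And>y. V (Suc t) y = y \<bullet> (S *v y) + l \<bullet> y + c"
      using assms(1) step.hyps by blast
    obtain p q where p: "square_integrable M p" "(\<integral>\<omega>. p \<omega> \<partial>M) = 0" and q: "integrable M q"
      and min: "\<And>\<omega> x. is_min_value (\<lambda>a. penalized_cost V a (\<lambda>s. \<xi> s \<omega>) (Suc t) x)
        (x \<bullet> (K (Suc t) *v x) + 2 * (p \<omega> \<bullet> x) + q \<omega>)"
      using step.IH by blast
    have noise: "square_integrable M (\<xi> t)" "(\<integral>\<omega>. \<xi> t \<omega> \<partial>M) = 0"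
      using noise_square_integrable noise_mean step.hyps by auto
    define h where "h \<omega> = K (Suc t) *v \<xi> t \<omega> + p \<omega> - S *v \<xi> t \<omega>" for \<omega>
    define p' where
      "p' \<omega> = transpose (D t) *v (closed_loop_adjoint (R t) (B t) (K (Suc t)) *v h \<omega>)" for \<omega>
    define q' where "q' \<omega> = q \<omega> + \<xi> t \<omega> \<bullet> (K (Suc t) *v \<xi> t \<omega>) + 2 * (p \<omega> \<bullet> \<xi> t \<omega>)
      + (\<integral>\<omega>. \<xi> t \<omega> \<bullet> (S *v \<xi> t \<omega>) \<partial>M) - \<xi> t \<omega> \<bullet> (S *v \<xi> t \<omega>) - l \<bullet> \<xi> t \<omega>
      - h \<omega> \<bullet> (B t *v (matrix_inv (gain_matrix (R t) (B t) (K (Suc t)))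
          *v (transpose (B t) *v h \<omega>)))" for \<omega>
    have int_mult: "integrable M (\<lambda>\<omega>. A *v f \<omega>) \<and> (\<integral>\<omega>. A *v f \<omega> \<partial>M) = A *v (\<integral>\<omega>. f \<omega> \<partial>M)"
      if "square_integrable M f" for A :: "real^'n^'n" and f
      using square_integrable_integrable[OF that]
      by (auto intro: integrable_bounded_linear integral_bounded_linear)
    have h: "square_integrable M h"
      unfolding h_def
      by (intro square_integrable_diff square_integrable_add square_integrable_mult p noise)
    have h0: "(\<integral>\<omega>. h \<omega> \<partial>M) = 0"
      unfolding h_def using int_mult[OF noise(1)] square_integrable_integrable[OF p(1)] p noise
      by simp
    have p': "square_integrable M p'" "(\<integral>\<omega>. p' \<omega> \<partial>M) = 0"
      unfolding p'_def
      by (intro square_integrable_mult h) (simp add: int_mult square_integrable_mult h h0)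
    moreover have "integrable M q'"
      unfolding q'_def
      by (intro Bochner_Integration.integrable_add Bochner_Integration.integrable_diff q
          square_integrable_inner square_integrable_mult noise p h square_integrable_const
          integrable_mult_right integrable_const)
    moreover have "is_min_value (\<lambda>a. penalized_cost V a (\<lambda>s. \<xi> s \<omega>) t x)
        (x \<bullet> (K t *v x) + 2 * (p' \<omega> \<bullet> x) + q' \<omega>)" for \<omega> x
      using min_value_step[of t S V l c "\<lambda>s. \<xi> s \<omega>", OF _ S V min] step.hyps
      unfolding p'_def q'_def h_def by simp
    ultimately show ?case
      by blast
  qed
  then obtain p q where p: "square_integrable M p" "(\<integral>\<omega>. p \<omega> \<partial>M) = 0" and q: "integrable M q"
    and min: "\<And>\<omega> x. is_min_value (\<lambda>a. penalized_cost V a (\<lambda>s. \<xi> s \<omega>) t x)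
        (x \<bullet> (K t *v x) + 2 * (p \<omega> \<bullet> x) + q \<omega>)"
    by blast
  have "ddp_step M \<xi> T D B Q R V t x = x \<bullet> (K t *v x) + (\<integral>\<omega>. q \<omega> \<partial>M)" for x
    unfolding ddp_step_eq[OF \<open>t \<le> T\<close> min]
    using p q square_integrable_integrable[OF p(1)] by (simp add: prob_space)
  then show ?thesis
    by blast
qed

text \<open>Here the pathwise minimal value is the same for all realizations \<open>w\<close>: the penalty of the
  optimal value function compensates the noise exactly (strong duality).\<close>

lemma ddp_step_optimal:
  assumes V: "\<And>t. t \<le> T \<Longrightarrow> \<exists>c. \<forall>x. V t x = x \<bullet> (K t *v x) + c"
    and "t \<le> T"
  shows "ddp_step M \<xi> T D B Q R V t x = opt_cost_to_go M \<xi> T D B Q R t x"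
proof -
  have "is_min_value (\<lambda>a. penalized_cost V a w t x) (opt_cost_to_go M \<xi> T D B Q R t x)" for w
    using \<open>t \<le> T\<close>
  proof (induction t arbitrary: x rule: inc_induct)
    case base
    show ?case
      using min_value_end by (simp add: opt_cost_to_go_def)
  next
    case (step t)
    obtain c where c: "\<And>y. V (Suc t) y = y \<bullet> (K (Suc t) *v y) + 0 \<bullet> y + c"
      using V[of "Suc t"] step.hyps by auto
    have K_sym: "transpose (K (Suc t)) = K (Suc t)"
      using K_psd[of "Suc t"] step.hyps unfolding sym_psd_def by simp
    let ?q = "\<Sum>s=Suc t..<T. \<integral>\<omega>. \<xi> s \<omega> \<bullet> (K (Suc s) *v \<xi> s \<omega>) \<partial>M"
    have "is_min_value (\<lambda>a. penalized_cost V a w (Suc t) y)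
        (y \<bullet> (K (Suc t) *v y) + 2 * (0 \<bullet> y) + ?q)" for y
      using step.IH[of y] by (simp add: opt_cost_to_go_def)
    from min_value_step[OF step.hyps(2) K_sym c this]
    show ?case
      using step.hyps
      by (simp add: opt_cost_to_go_def sum.atLeast_Suc_lessThan add.commute)
  qed
  from ddp_step_eq[OF \<open>t \<le> T\<close> this] show ?thesis
    by (simp add: prob_space)
qed

text \<open>Under an affine policy the state moves by a random affine map \<open>x \<mapsto> A x + b\<close>, whose linear part is
  deterministic. Composing a quadratic polynomial with such maps backwards in time keeps the quadratic
  part deterministic and the remaining coefficients integrable.\<close>

lemma affine_policy_cost_quadratic:
  assumes "t \<le> T"
  shows "\<exists>S l c. transpose S = S \<and>
    (\<forall>x. policy_cost M \<xi> T D B Q R (\<lambda>t x. P t *v x + E t) t x = x \<bullet> (S *v x) + l \<bullet> x + c)"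
proof -
  let ?u = "\<lambda>t x. P t *v x + E t"
  have "\<exists>S p q. sym_psd S \<and> square_integrable M p \<and> integrable M q \<and>
    (\<forall>\<omega> x. lq_cost T D B Q R ?u (\<lambda>s. \<xi> s \<omega>) t x = x \<bullet> (S *v x) + 2 * (p \<omega> \<bullet> x) + q \<omega>)"
    using assms
  proof (induction t rule: inc_induct)
    case base
    show ?case
      by (rule exI[of _ "Q T"], rule exI[of _ "\<lambda>_. 0"], rule exI[of _ "\<lambda>_. 0"])
        (simp add: square_integrable_const lq_cost_end Q_psd)
  next
    case (step t)
    obtain S p q where S: "sym_psd S" and p: "square_integrable M p" and q: "integrable M q"
      and cost: "\<And>\<omega> x. lq_cost T D B Q R ?u (\<lambda>s. \<xi> s \<omega>) (Suc t) x =
        x \<bullet> (S *v x) + 2 * (p \<omega> \<bullet> x) + q \<omega>"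
      using step.IH by blast
    have R: "sym_psd (R t)"
      using R_pd[OF step.hyps(2)] unfolding sym_psd_def sym_pd_def
      by (metis inner_zero_left less_imp_le order_refl)
    have noise: "square_integrable M (\<xi> t)"
      using noise_square_integrable step.hyps by auto
    \<comment> \<open>under the policy the successor of \<open>x\<close> is \<open>A x + b \<omega>\<close>\<close>
    define A where "A = D t + B t ** P t"
    define b where "b \<omega> = B t *v E t + \<xi> t \<omega>" for \<omega>
    define S' where "S' = transpose A ** S ** A + (transpose (P t) ** R t ** P t + Q t)"
    define p' where
      "p' \<omega> = transpose (P t) *v (R t *v E t) + transpose A *v (S *v b \<omega> + p \<omega>)" for \<omega>
    define q' where
      "q' \<omega> = E t \<bullet> (R t *v E t) + b \<omega> \<bullet> (S *v b \<omega>) + 2 * (p \<omega> \<bullet> b \<omega>) + q \<omega>" for \<omega>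
    have b: "square_integrable M b"
      unfolding b_def by (intro square_integrable_add square_integrable_const noise)
    have "sym_psd S'"
      unfolding S'_def using S R Q_psd step.hyps by (intro congruence_plus_psd) auto
    moreover have "square_integrable M p'"
      unfolding p'_def
      by (intro square_integrable_add square_integrable_mult square_integrable_const b p)
    moreover have "integrable M q'"
      unfolding q'_def
      by (intro Bochner_Integration.integrable_add integrable_const integrable_mult_right
          square_integrable_inner square_integrable_mult b p q)
    moreover have "lq_cost T D B Q R ?u (\<lambda>s. \<xi> s \<omega>) t x =
        x \<bullet> (S' *v x) + 2 * (p' \<omega> \<bullet> x) + q' \<omega>" for \<omega> x
    proof -
      have next_state: "D t *v x + B t *v ?u t x + \<xi> t \<omega> = A *v x + b \<omega>"
        by (simp add: A_def b_def matrix_vector_right_distrib matrix_vector_mult_add_rdistrib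
            matrix_vector_mul_assoc)
      have S': "x \<bullet> (S' *v x) = (A *v x) \<bullet> (S *v (A *v x))
          + (P t *v x) \<bullet> (R t *v (P t *v x)) + x \<bullet> (Q t *v x)"
        by (simp add: S'_def matrix_vector_mult_add_rdistrib matrix_vector_mul_assoc[symmetric]
            inner_add_right inner_mult_left[of A] inner_mult_left[of "P t"])
      have p': "p' \<omega> \<bullet> x = (R t *v E t) \<bullet> (P t *v x) + (S *v b \<omega> + p \<omega>) \<bullet> (A *v x)"
        by (simp add: p'_def inner_add_left inner_transpose_mult_left)
      have sym: "transpose S = S" "transpose (R t) = R t"
        using S R unfolding sym_psd_def by auto
      show ?thesis
        unfolding lq_cost_step[OF step.hyps(2)] next_state cost S' p' q'_def
          quadratic_shift[OF sym(1)] quadratic_shift[OF sym(2)]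
        by (simp add: inner_add_left inner_add_right)
    qed
    ultimately show ?case
      by blast
  qed
  then obtain S p q where S: "sym_psd S" and p: "square_integrable M p" and q: "integrable M q"
    and cost: "\<And>\<omega> x. lq_cost T D B Q R ?u (\<lambda>s. \<xi> s \<omega>) t x =
      x \<bullet> (S *v x) + 2 * (p \<omega> \<bullet> x) + q \<omega>"
    by blast
  have "policy_cost M \<xi> T D B Q R ?u t x =
      x \<bullet> (S *v x) + (2 *\<^sub>R (\<integral>\<omega>. p \<omega> \<partial>M)) \<bullet> x + (\<integral>\<omega>. q \<omega> \<partial>M)" for x
    unfolding policy_cost_def cost
    using q square_integrable_integrable[OF p] by (simp add: prob_space)
  then show ?thesis
    using S unfolding sym_psd_def by blast
qed

lemma ddp_optimal_after_two:
  assumes V0: "\<And>t. t \<le> T \<Longrightarrow>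
      \<exists>S l c. transpose S = S \<and> (\<forall>y. V0 t y = y \<bullet> (S *v y) + l \<bullet> y + c)"
    and "2 \<le> k" and "t \<le> T"
  shows "ddp M \<xi> T D B Q R V0 k t x = opt_cost_to_go M \<xi> T D B Q R t x"
  using \<open>2 \<le> k\<close> \<open>t \<le> T\<close>
proof (induction k arbitrary: t x rule: dec_induct)
  case base
  have "\<exists>c. \<forall>x. ddp_step M \<xi> T D B Q R V0 t x = x \<bullet> (K t *v x) + c" if "t \<le> T" for t
    using V0 that by (intro ddp_step_quadratic) auto
  from ddp_step_optimal[OF this base] show ?case
    by (simp add: ddp_def numeral_2_eq_2)
next
  case (step k)
  have "\<exists>c. \<forall>x. ddp M \<xi> T D B Q R V0 k t x = x \<bullet> (K t *v x) + c" if "t \<le> T" for t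
    using step.IH[OF that] by (auto simp: opt_cost_to_go_def)
  from ddp_step_optimal[OF this step.prems] show ?case
    by (simp add: ddp_def)
qed

end

theorem proposition3p4:
  fixes M :: "'w measure"
    and \<xi> :: "nat \<Rightarrow> 'w \<Rightarrow> real^'n"
    and T :: nat
    and D :: "nat \<Rightarrow> real^'n^'n"
    and B :: "nat \<Rightarrow> real^'m^'n"
    and Q :: "nat \<Rightarrow> real^'n^'n"
    and R :: "nat \<Rightarrow> real^'m^'m"
    and P :: "nat \<Rightarrow> real^'n^'m"
    and E :: "nat \<Rightarrow> real^'m"
  assumes "prob_space M"
    and "prob_space.indep_vars M (\<lambda>_. borel) \<xi> {..<T}"
    and "\<And>t. t < T \<Longrightarrow> integrable M (\<lambda>\<omega>. (norm (\<xi> t \<omega>))\<^sup>2)"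
    and "\<And>t. t < T \<Longrightarrow> (\<integral>\<omega>. \<xi> t \<omega> \<partial>M) = 0"
    and "\<And>t. t \<le> T \<Longrightarrow> sym_psd (Q t)"
    and "\<And>t. t < T \<Longrightarrow> sym_pd (R t)"
  shows "\<forall>k\<ge>2. \<forall>t\<le>T. \<forall>x.
    ddp M \<xi> T D B Q R (policy_cost M \<xi> T D B Q R (\<lambda>t x. P t *v x + E t)) k t x
    = opt_cost_to_go M \<xi> T D B Q R t x"
proof (intro allI impI)
  fix k t :: nat and x :: "real^'n"
  assume kt: "2 \<le> k" "t \<le> T"
  interpret prob_space M by fact
  have "\<xi> t \<in> borel_measurable M" if "t < T" for t
    using assms(2) that unfolding indep_vars_def by auto
  then interpret lq_control M \<xi> T D B Q R
    using assms by unfold_locales (auto simp: square_integrable_def)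
  show "ddp M \<xi> T D B Q R (policy_cost M \<xi> T D B Q R (\<lambda>t x. P t *v x + E t)) k t x
      = opt_cost_to_go M \<xi> T D B Q R t x"
    using affine_policy_cost_quadratic kt by (rule ddp_optimal_after_two)
qed

end
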